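(* Let $\mathbb{F}$ be a field. There exist constants $\epsilon>0$, $c>0$ and $n_0$ such that the following holds for every integer $n\ge n_0$, with $N=n^2$. Let $\lambda\le 1/30$, let $s,t$ be positive integers with $t\le N^{1/30}$, and for $1\le i\le s$, $1\le j\le t$ let $f_{i,j}$ be read-once polynomials over $\mathbb{F}$ in the $N$ variables $\{x_{k,l}\}_{1\le k,l\le n}$ with $s_{f_{i,j}}\le N^{1/2+\lambda}$. If $$\sum_{i=1}^{s}\prod_{j=1}^{t} f_{i,j}=\mathrm{perm}_n,$$ then $s\ge 2^{cN^{\epsilon}}$.
   Context: $\mathrm{perm}_n=\sum_{\pi\in S_n}\prod_{i=1}^n x_{i,\pi(i)}$ is the permanent of the $n\times n$ matrix of variables $(x_{i,j})$. An arithmetic formula over $\mathbb{F}$ is a rooted binary tree whose leaves are labelled by variables or elements of $\mathbb{F}$ and whose internal nodes (gates) are labelled $+$ or $\times$; it computes a polynomial in the natural way. Formulas are assumed constant-minimal: no gate has both its children constants. A read-once formula (ROF) is an arithmetic formula in which every variable labels at most one leaf; a read-once polynomial (ROP) is a polynomial computed by some ROF. For a gate $v$ of an ROF $F$, let $\text{sum-fan-in}(v)$ be the number of variables in the sub-formula rooted at $v$ whose parent is labelled $+$. Here scalar multiplications are not regarded as $\times$ gates: a $\times$ gate one of whose children is a constant is contracted (treated as a scalar coefficient on an edge) when determining the parent of a variable. Let $s_F$ be the maximum of $\text{sum-fan-in}(v)$ over all $+$ gates $v$ of $F$ excluding the top layer of $+$ gates, i.e. excluding those $+$ gates all of whose proper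 ancestors are $+$ gates (in particular the root, if it is a $+$ gate); the maximum over an empty set is $0$. (For a $\Sigma\Pi\Sigma$ formula $s_F$ is the bottom $\Sigma$-fan-in.) For an ROP $f$, $s_f$ is the smallest value of $s_F$ over all ROFs $F$ computing $f$. *)

theory Defs
  imports
    Complex_Main
    "HOL-Library.Poly_Mapping"
    "HOL-Combinatorics.Permutations"
begin

type_synonym ('v, 'a) mpoly = "('v \<Rightarrow>\<^sub>0 nat) \<Rightarrow>\<^sub>0 'a"

definition mp_const :: "'a \<Rightarrow> ('v, 'a::comm_ring_1) mpoly" where
  "mp_const c = Poly_Mapping.single 0 c"

definition mp_var :: "'v \<Rightarrow> ('v, 'a::comm_ring_1) mpoly" where
  "mp_var v = Poly_Mapping.single (Poly_Mapping.single v 1) 1"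

definition permanent_poly :: "nat \<Rightarrow> (nat \<times> nat, 'a::comm_ring_1) mpoly" where
  "permanent_poly n = (\<Sum>p | p permutes {1..n}. \<Prod>i = 1..n. mp_var (i, p i))"


datatype ('v, 'a) formula =
    Var 'v
  | is_Const: Const 'a
  | Plus "('v, 'a) formula" "('v, 'a) formula"
  | Times "('v, 'a) formula" "('v, 'a) formula"

fun poly_of :: "('v, 'a::comm_ring_1) formula \<Rightarrow> ('v, 'a) mpoly" where
  "poly_of (Var v) = mp_var v"
| "poly_of (Const c) = mp_const c"
| "poly_of (Plus F G) = poly_of F + poly_of G"
| "poly_of (Times F G) = poly_of F * poly_of G"

fun var_leaves :: "('v, 'a) formula \<Rightarrow> 'v list" where
  "var_leaves (Var v) = [v]"
| "var_leaves (Const c) = []"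
| "var_leaves (Plus F G) = var_leaves F @ var_leaves G"
| "var_leaves (Times F G) = var_leaves F @ var_leaves G"

fun constant_minimal :: "('v, 'a) formula \<Rightarrow> bool" where
  "constant_minimal (Var v) \<longleftrightarrow> True"
| "constant_minimal (Const c) \<longleftrightarrow> True"
| "constant_minimal (Plus F G) \<longleftrightarrow>
     \<not> (is_Const F \<and> is_Const G) \<and> constant_minimal F \<and> constant_minimal G"
| "constant_minimal (Times F G) \<longleftrightarrow>
     \<not> (is_Const F \<and> is_Const G) \<and> constant_minimal F \<and> constant_minimal G"

definition rofs :: "'v set \<Rightarrow> ('v, 'a) formula set" where
  "rofs X = {F. constant_minimal F \<and> distinct (var_leaves F) \<and> set (var_leaves F) \<subseteq> X}"

definition is_rop :: "'v set \<Rightarrow> ('v, 'a::comm_ring_1) mpoly \<Rightarrow> bool" where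
  "is_rop X f \<longleftrightarrow> (\<exists>F \<in> rofs X. poly_of F = f)"


text \<open>
  The variables of a formula whose parent is labelled \<open>+\<close>. The flag \<open>b\<close> says whether the parent
  of the root of the formula is a \<open>+\<close> gate. A \<open>\<times>\<close> gate with a constant child is a scalar
  coefficient on an edge, so it hands its own parent on to its children.
\<close>

fun plus_vars :: "bool \<Rightarrow> ('v, 'a) formula \<Rightarrow> 'v set" where
  "plus_vars b (Var v) = (if b then {v} else {})"
| "plus_vars b (Const c) = {}"
| "plus_vars b (Plus F G) = plus_vars True F \<union> plus_vars True G"
| "plus_vars b (Times F G) =
     (let b' = (b \<and> (is_Const F \<or> is_Const G)) in plus_vars b' F \<union> plus_vars b' G)"

text \<open>
  Used for \<open>+\<close> gates only, where the value of the flag at the root is irrelevant.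
\<close>

definition sum_fan_in :: "('v, 'a) formula \<Rightarrow> nat" where
  "sum_fan_in F = card (plus_vars False F)"

text \<open>
  A gate is represented by the sub-formula rooted at it. A \<open>+\<close> gate lies outside the top layer
  iff some proper ancestor of it is a \<open>\<times>\<close> gate. Scalar multiplications are not contracted at
  this point; the value of \<open>s_rop\<close> is the same either way, because a scalar above top-layer
  \<open>+\<close> gates can be pushed through them.
\<close>

fun plus_gates :: "('v, 'a) formula \<Rightarrow> ('v, 'a) formula set" where
  "plus_gates (Var v) = {}"
| "plus_gates (Const c) = {}"
| "plus_gates (Plus F G) = insert (Plus F G) (plus_gates F \<union> plus_gates G)"
| "plus_gates (Times F G) = plus_gates F \<union> plus_gates G"

fun lower_plus_gates :: "('v, 'a) formula \<Rightarrow> ('v, 'a) formula set" where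
  "lower_plus_gates (Var v) = {}"
| "lower_plus_gates (Const c) = {}"
| "lower_plus_gates (Plus F G) = lower_plus_gates F \<union> lower_plus_gates G"
| "lower_plus_gates (Times F G) = plus_gates F \<union> plus_gates G"

definition s_formula :: "('v, 'a) formula \<Rightarrow> nat" where
  "s_formula F = Max (insert 0 (sum_fan_in ` lower_plus_gates F))"

text \<open>Meaningful only if \<open>is_rop X f\<close>.\<close>

definition s_rop :: "'v set \<Rightarrow> ('v, 'a::comm_ring_1) mpoly \<Rightarrow> nat" where
  "s_rop X f = (LEAST m. \<exists>F \<in> rofs X. poly_of F = f \<and> s_formula F = m)"

end

theory Submission
  imports Defs "HOL-Library.Function_Algebras" "HOL-Real_Asymp.Real_Asymp"
begin

text \<open>
  Split the variables into a small set \<open>Z\<close> and its complement \<open>Y\<close>, and consider the matrix of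
  coefficients whose rows are monomials of fixed degree \<open>k\<close> in \<open>Y\<close> and whose columns are monomials in
  \<open>Z\<close>. If a read-once formula has \<open>r\<close> leaves in \<open>Z\<close>, then the polynomial it computes is a sum of
  products \<open>g(Y) h(Z)\<close> in which the number of \<open>g\<close> of order \<open>d\<close> is controlled by the coefficient of
  \<open>x ^ d\<close> in \<open>(1 + x) ^ (4 * r + 1)\<close>. A product of \<open>t\<close> of them thus gives rank at most
  \<open>3 * D ^ k\<close> for \<open>D = t * (4 * r + 1)\<close>. For the permanent there is a set \<open>Z\<close> of size at most \<open>3 * n\<close>
  such that this matrix contains an identity matrix of size \<open>b ^ (2 * k)\<close>, where \<open>k \<approx> n powr (1 / 5)\<close>
  and \<open>b \<approx> n powr (7 / 10)\<close>. As \<open>D\<close> is of order \<open>n powr (16 / 15)\<close>, which is much less than \<open>b\<^sup>2\<close>,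
  at least \<open>2 ^ k\<close> summands are needed.
\<close>

abbreviation lookup :: "('b \<Rightarrow>\<^sub>0 'c::zero) \<Rightarrow> 'b \<Rightarrow> 'c" where
  "lookup \<equiv> Poly_Mapping.lookup"

abbreviation keys :: "('b \<Rightarrow>\<^sub>0 'c::zero) \<Rightarrow> 'b set" where
  "keys \<equiv> Poly_Mapping.keys"

section \<open>Linear algebra: the rank of an identity matrix\<close>

text \<open>The equation writes each row of the identity matrix as a combination of the
  \<open>q\<close> vectors \<open>v l\<close>, and these rows are linearly independent.\<close>

lemma rank_one_sum_identity:
  fixes u v :: "nat \<Rightarrow> 'i \<Rightarrow> 'a::field"
  assumes fin: "finite I"
    and id: "\<And>i j. i \<in> I \<Longrightarrow> j \<in> I \<Longrightarrow> (\<Sum>l<q. u l i * v l j) = (if i = j then 1 else 0)"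
  shows "card I \<le> q"
proof -
  interpret V: vector_space "\<lambda>(c::'a) (f::'i \<Rightarrow> 'a) x. c * f x"
    by standard (auto simp: fun_eq_iff algebra_simps)
  define e :: "'i \<Rightarrow> 'i \<Rightarrow> 'a" where "e i = (\<lambda>j. if i = j then 1 else 0)" for i
  \<comment> \<open>The equation says nothing about \<open>v l\<close> outside \<open>I\<close>, so
    it is cut off there, where the unit vectors vanish too.\<close>
  define w :: "nat \<Rightarrow> 'i \<Rightarrow> 'a" where "w l = (\<lambda>j. if j \<in> I then v l j else 0)" for l
  have sum_apply: "sum F A x = (\<Sum>l\<in>A. F l x)" for F :: "'b \<Rightarrow> 'i \<Rightarrow> 'a" and A x
    by (induction A rule: infinite_finite_induct) auto
  have inj: "inj_on e I"
    by (auto simp: inj_on_def e_def fun_eq_iff split: if_splits)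
  have "V.independent (e ` I)"
  proof -
    have "c (e i) = 0" if c: "(\<Sum>f\<in>e ` I. (\<lambda>x. c f * f x)) = 0" and i: "i \<in> I" for c i
    proof -
      have "0 = (\<Sum>f\<in>e ` I. (\<lambda>x. c f * f x)) i"
        using c by simp
      also have "\<dots> = (\<Sum>j\<in>I. c (e j) * e j i)"
        by (simp add: sum_apply sum.reindex[OF inj])
      also have "\<dots> = (\<Sum>j\<in>I. if j = i then c (e j) else 0)"
        by (intro sum.cong) (auto simp: e_def)
      also have "\<dots> = c (e i)"
        using fin i by simp
      finally show ?thesis by simp
    qed
    then show ?thesis
      using fin by (auto simp: V.dependent_finite)
  qed
  moreover have "e ` I \<subseteq> V.span (w ` {..<q})"
  proof safe
    fix i assume i: "i \<in> I"
    have "e i = (\<Sum>l<q. (\<lambda>x. u l i * w l x))"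
    proof
      fix j show "e i j = (\<Sum>l<q. (\<lambda>x. u l i * w l x)) j"
        using id[OF i, of j] i by (cases "j \<in> I") (auto simp: sum_apply e_def w_def)
    qed
    also have "\<dots> \<in> V.span (w ` {..<q})"
      by (intro V.span_sum V.span_scale V.span_base) auto
    finally show "e i \<in> V.span (w ` {..<q})" .
  qed
  ultimately have "card (e ` I) \<le> card (w ` {..<q})"
    using V.independent_span_bound[of "w ` {..<q}" "e ` I"] by simp
  also have "\<dots> \<le> q"
    by (metis card_image_le card_lessThan finite_lessThan)
  finally show ?thesis
    by (simp add: card_image[OF inj])
qed

section \<open>Degrees of monomials, and polynomials separated by \<open>Z\<close>\<close>

definition mdeg :: "('v \<Rightarrow>\<^sub>0 nat) \<Rightarrow> nat" where
  "mdeg a = (\<Sum>v\<in>keys a. lookup a v)"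

lemma keys_plus_nat: "keys (a + b) = keys a \<union> keys (b :: 'v \<Rightarrow>\<^sub>0 nat)"
  by (auto simp: in_keys_iff lookup_add)

lemma mdeg_plus: "mdeg (a + b) = mdeg a + mdeg b"
proof -
  have "mdeg c = (\<Sum>v\<in>keys a \<union> keys b. lookup c v)" if "keys c \<subseteq> keys a \<union> keys b" for c
    unfolding mdeg_def using that by (intro sum.mono_neutral_left) (auto simp: in_keys_iff)
  then show ?thesis
    by (simp add: keys_plus_nat lookup_add sum.distrib)
qed

lemma mdeg_eq_0_iff [simp]: "mdeg a = 0 \<longleftrightarrow> a = 0"
  by (auto simp: mdeg_def in_keys_iff poly_mapping_eq_iff fun_eq_iff)

lemma mdeg_sum: "mdeg (sum f A) = (\<Sum>i\<in>A. mdeg (f i))"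
  by (induction A rule: infinite_finite_induct) (auto simp: mdeg_plus)

lemma mdeg_single [simp]: "mdeg (Poly_Mapping.single v c) = c"
  by (simp add: mdeg_def)

text \<open>Only a lower bound on the degrees is demanded: it survives sums and adds up under
  products.\<close>

definition off_ord :: "'v set \<Rightarrow> nat \<Rightarrow> ('v, 'a::comm_ring_1) mpoly \<Rightarrow> bool" where
  "off_ord Z d g \<longleftrightarrow> (\<forall>a\<in>keys g. keys a \<inter> Z = {} \<and> d \<le> mdeg a)"

definition poly_in :: "'v set \<Rightarrow> ('v, 'a::comm_ring_1) mpoly \<Rightarrow> bool" where
  "poly_in Z h \<longleftrightarrow> (\<forall>a\<in>keys h. keys a \<subseteq> Z)"

lemma off_ord_0 [simp]: "off_ord Z d 0"
  by (simp add: off_ord_def)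

lemma off_ord_const [simp]: "off_ord Z 0 (mp_const c)"
  by (auto simp: off_ord_def mp_const_def)

lemma off_ord_var: "v \<notin> Z \<Longrightarrow> off_ord Z 0 (mp_var v)"
  by (auto simp: off_ord_def mp_var_def)

lemma off_ord_1 [simp]: "off_ord Z 0 1"
  by (auto simp: off_ord_def)

lemma off_ord_add: "off_ord Z d f \<Longrightarrow> off_ord Z d g \<Longrightarrow> off_ord Z d (f + g)"
  using keys_add[of f g] by (auto simp: off_ord_def)

lemma off_ord_mult: "off_ord Z d f \<Longrightarrow> off_ord Z d' g \<Longrightarrow> off_ord Z (d + d') (f * g)"
  using keys_mult[of f g] by (fastforce simp: off_ord_def keys_plus_nat mdeg_plus intro: add_mono)

lemma poly_in_1 [simp]: "poly_in Z 1"
  by (auto simp: poly_in_def)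

lemma poly_in_var: "v \<in> Z \<Longrightarrow> poly_in Z (mp_var v)"
  by (auto simp: poly_in_def mp_var_def)

lemma poly_in_add: "poly_in Z f \<Longrightarrow> poly_in Z g \<Longrightarrow> poly_in Z (f + g)"
  using keys_add[of f g] by (auto simp: poly_in_def)

lemma poly_in_mult: "poly_in Z f \<Longrightarrow> poly_in Z g \<Longrightarrow> poly_in Z (f * g)"
  using keys_mult[of f g] by (fastforce simp: poly_in_def keys_plus_nat)

lemma poly_mapping_sum_singles: "f = (\<Sum>a\<in>keys f. Poly_Mapping.single a (lookup f a))"
  by (rule poly_mapping_eqI) (auto simp: lookup_sum lookup_single when_def in_keys_iff)

lemma split_monomial_unique:
  fixes a b a' b' :: "'v \<Rightarrow>\<^sub>0 nat"
  assumes "keys a \<inter> Z = {}" "keys a' \<inter> Z = {}" "keys b \<subseteq> Z" "keys b' \<subseteq> Z"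
    and eq: "a + b = a' + b'"
  shows "a = a' \<and> b = b'"
proof -
  have "lookup a v = lookup a' v \<and> lookup b v = lookup b' v" for v
  proof -
    have "lookup a v + lookup b v = lookup a' v + lookup b' v"
      using eq by (metis lookup_add)
    moreover have "v \<in> Z \<Longrightarrow> lookup a v = 0 \<and> lookup a' v = 0"
      and "v \<notin> Z \<Longrightarrow> lookup b v = 0 \<and> lookup b' v = 0"
      using assms(1-4) by (auto simp: in_keys_iff)
    ultimately show ?thesis
      by (cases "v \<in> Z") auto
  qed
  then show ?thesis
    by (auto simp: poly_mapping_eq_iff fun_eq_iff)
qed

text \<open>A monomial splits in only one way into a part off \<open>Z\<close> and a part in
  \<open>Z\<close>, so a single term of the convolution survives. Hence \<open>g * h\<close> has a
  coefficient matrix of rank at most one.\<close>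

lemma lookup_mult_split:
  fixes g h :: "('v, 'a::comm_ring_1) mpoly"
  assumes g: "off_ord Z d g" and h: "poly_in Z h"
    and a: "keys a \<inter> Z = {}" and b: "keys b \<subseteq> Z"
  shows "lookup (g * h) (a + b) = lookup g a * lookup h b"
proof -
  have "g * h = (\<Sum>p\<in>keys g. \<Sum>q\<in>keys h. Poly_Mapping.single (p + q) (lookup g p * lookup h q))"
    by (subst (1) poly_mapping_sum_singles[of g], subst (1) poly_mapping_sum_singles[of h])
       (simp add: sum_product mult_single)
  then have "lookup (g * h) (a + b) =
      (\<Sum>p\<in>keys g. \<Sum>q\<in>keys h. (lookup g p * lookup h q when p + q = a + b))"
    by (simp add: lookup_sum lookup_single)
  also have "\<dots> = (\<Sum>p\<in>keys g. \<Sum>q\<in>keys h.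
      if q = b then (if p = a then lookup g p * lookup h q else 0) else 0)"
  proof (intro sum.cong refl)
    fix p q assume "p \<in> keys g" "q \<in> keys h"
    then have "p + q = a + b \<longleftrightarrow> p = a \<and> q = b"
      using split_monomial_unique[of p Z a q b] g h a b by (auto simp: off_ord_def poly_in_def)
    then show "(lookup g p * lookup h q when p + q = a + b) =
        (if q = b then (if p = a then lookup g p * lookup h q else 0) else 0)"
      by (auto simp: when_def)
  qed
  also have "\<dots> = lookup g a * lookup h b"
    by (cases "lookup h b = 0") (simp_all add: in_keys_iff)
  finally show ?thesis .
qed

section \<open>Weighted sums of products and the rank they allow\<close>

text \<open>
  The real number \<open>x\<close> stands for the variable of a generating function: a summand \<open>g * h\<close> whose
  \<open>Y\<close>-part \<open>g\<close> has order \<open>d\<close> contributes \<open>x ^ d\<close>. Weights multiply under products, and at most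
  \<open>w / x ^ k\<close> summands can affect coefficients of \<open>Y\<close>-degree \<open>k\<close>.
\<close>

inductive wsum :: "'v set \<Rightarrow> real \<Rightarrow> real \<Rightarrow> ('v, 'a::comm_ring_1) mpoly \<Rightarrow> bool"
  for Z :: "'v set" and x :: real where
  wsum_0: "wsum Z x 0 0"
| wsum_step: "wsum Z x w f \<Longrightarrow> off_ord Z d g \<Longrightarrow> poly_in Z h \<Longrightarrow> wsum Z x (w + x ^ d) (f + g * h)"

lemma wsum_single: "off_ord Z d g \<Longrightarrow> poly_in Z h \<Longrightarrow> wsum Z x (x ^ d) (g * h)"
  using wsum_step[OF wsum_0] by fastforce

lemma wsum_nonneg: "wsum Z x w f \<Longrightarrow> 0 \<le> x \<Longrightarrow> 0 \<le> w"
  by (induction rule: wsum.induct) auto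

lemma wsum_add:
  assumes "wsum Z x w f" "wsum Z x w' f'"
  shows "wsum Z x (w + w') (f + f')"
  using assms(2)
proof (induction rule: wsum.induct)
  case wsum_0
  then show ?case using assms(1) by simp
next
  case (wsum_step w' f' d g h)
  then show ?case
    using wsum.wsum_step[of Z x "w + w'" "f + f'" d g h] by (simp add: add.assoc)
qed

lemma wsum_sum:
  assumes "\<And>i. i \<in> A \<Longrightarrow> wsum Z x (w i) (f i)"
  shows "wsum Z x (sum w A) (sum f A)"
  using assms
  by (induction A rule: infinite_finite_induct) (auto intro: wsum_add wsum_0)

lemma wsum_term_mult:
  assumes "wsum Z x w f" and g: "off_ord Z d g" and h: "poly_in Z h"
  shows "wsum Z x (x ^ d * w) (g * h * f)"
  using assms(1)
proof (induction rule: wsum.induct)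
  case wsum_0
  then show ?case by (simp add: wsum.wsum_0)
next
  case (wsum_step w f d' g' h')
  then show ?case
    using wsum.wsum_step[OF wsum_step.IH off_ord_mult[OF g wsum_step.hyps(2)]
        poly_in_mult[OF h wsum_step.hyps(3)]]
    by (simp add: algebra_simps power_add)
qed

lemma wsum_mult:
  assumes "wsum Z x w f" "wsum Z x w' f'"
  shows "wsum Z x (w * w') (f * f')"
  using assms(2)
proof (induction rule: wsum.induct)
  case wsum_0
  then show ?case by (simp add: wsum.wsum_0)
next
  case (wsum_step w' f' d g h)
  then show ?case
    using wsum_add[OF wsum_step.IH wsum_term_mult[OF assms(1) wsum_step.hyps(2,3)]]
    by (simp add: algebra_simps)
qed

text \<open>A summand with \<open>d \<le> k\<close> adds one rank-one matrix and pays for it with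
  \<open>x ^ d \<ge> x ^ k\<close>. A summand with \<open>d > k\<close> vanishes on rows of degree
  \<open>k\<close>.\<close>

lemma wsum_coeff_rank:
  fixes f :: "('v, 'a::comm_ring_1) mpoly" and \<alpha> \<beta> :: "'i \<Rightarrow> ('v \<Rightarrow>\<^sub>0 nat)"
  assumes "wsum Z x w f" and x: "0 < x" "x \<le> 1"
    and \<alpha>: "\<And>i. i \<in> I \<Longrightarrow> keys (\<alpha> i) \<inter> Z = {} \<and> mdeg (\<alpha> i) = k"
    and \<beta>: "\<And>i. i \<in> I \<Longrightarrow> keys (\<beta> i) \<subseteq> Z"
  shows "\<exists>q u v. real q * x ^ k \<le> w \<and>
    (\<forall>i\<in>I. \<forall>j\<in>I. lookup f (\<alpha> i + \<beta> j) = (\<Sum>l<q. u l i * v l j))"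
  using assms(1)
proof (induction rule: wsum.induct)
  case wsum_0
  then show ?case by (intro exI[of _ 0]) auto
next
  case (wsum_step w f d g h)
  then obtain q u v where q: "real q * x ^ k \<le> w"
    and uv: "\<forall>i\<in>I. \<forall>j\<in>I. lookup f (\<alpha> i + \<beta> j) = (\<Sum>l<q. u l i * v l j)"
    by blast
  have split: "lookup (g * h) (\<alpha> i + \<beta> j) = lookup g (\<alpha> i) * lookup h (\<beta> j)"
    if "i \<in> I" "j \<in> I" for i j
    using lookup_mult_split wsum_step.hyps(2,3) \<alpha> \<beta> that by blast
  show ?case
  proof (cases "d \<le> k")
    case True
    then have "x ^ k \<le> x ^ d"
      using x by (intro power_decreasing) auto
    then have "real (Suc q) * x ^ k \<le> w + x ^ d"
      using q by (simp add: algebra_simps)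
    moreover have "\<forall>i\<in>I. \<forall>j\<in>I. lookup (f + g * h) (\<alpha> i + \<beta> j) =
        (\<Sum>l<Suc q. (u(q := \<lambda>i. lookup g (\<alpha> i))) l i * (v(q := \<lambda>j. lookup h (\<beta> j))) l j)"
      using uv split by (auto simp: lookup_add)
    ultimately show ?thesis by blast
  next
    case False
    then have "lookup g (\<alpha> i) = 0" if "i \<in> I" for i
      using wsum_step.hyps(2) \<alpha>[OF that] by (auto simp: off_ord_def in_keys_iff)
    then have "\<forall>i\<in>I. \<forall>j\<in>I. lookup (f + g * h) (\<alpha> i + \<beta> j) = (\<Sum>l<q. u l i * v l j)"
      using uv split by (simp add: lookup_add)
    moreover have "real q * x ^ k \<le> w + x ^ d"
      using q x by (smt (verit) zero_less_power)
    ultimately show ?thesis by blast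
  qed
qed

text \<open>
  Splitting off one summand \<open>h\<close> with \<open>Y\<close>-part \<open>1\<close> makes the bound multiplicative under sums as
  well: the two split-off summands merge into one.
\<close>

definition narrow :: "'v set \<Rightarrow> real \<Rightarrow> nat \<Rightarrow> ('v, 'a::comm_ring_1) mpoly \<Rightarrow> bool" where
  "narrow Z x m f \<longleftrightarrow>
    (\<exists>h f' w. f = h + f' \<and> poly_in Z h \<and> wsum Z x w f' \<and> 1 + w \<le> (1 + x) ^ m)"

lemma narrow_mono:
  assumes "narrow Z x m f" "m \<le> m'" "0 \<le> x"
  shows "narrow Z x m' f"
proof -
  obtain h r w where "f = h + r" "poly_in Z h" "wsum Z x w r" "1 + w \<le> (1 + x) ^ m"
    using assms(1) by (auto simp: narrow_def)
  moreover have "(1 + x) ^ m \<le> (1 + x) ^ m'"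
    using assms by (intro power_increasing) auto
  ultimately have "1 + w \<le> (1 + x) ^ m'"
    by linarith
  with \<open>f = h + r\<close> \<open>poly_in Z h\<close> \<open>wsum Z x w r\<close> show ?thesis
    unfolding narrow_def by blast
qed

lemma narrow_poly_in: "poly_in Z h \<Longrightarrow> narrow Z x 0 h"
  unfolding narrow_def by (intro exI[of _ h] exI[of _ 0]) (auto intro: wsum_0)

text \<open>The constant term goes into the split-off summand; all other monomials have degree at
  least 1, so the remainder has weight \<open>x\<close>.\<close>

lemma narrow_off_ord:
  assumes g: "off_ord Z 0 g"
  shows "narrow Z x 1 g"
proof -
  define c where "c = Poly_Mapping.single (0 :: 'a \<Rightarrow>\<^sub>0 nat) (lookup g 0)"
  have "keys (g - c) \<subseteq> keys g - {0}"
    by (auto simp: c_def in_keys_iff lookup_minus lookup_single when_def split: if_splits)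
  then have "off_ord Z 1 (g - c)"
    using g by (force simp: off_ord_def Suc_le_eq simp flip: neq0_conv)
  then have "wsum Z x (x ^ 1) ((g - c) * 1)"
    by (intro wsum_single) auto
  moreover have "poly_in Z c"
    by (auto simp: c_def poly_in_def)
  ultimately show ?thesis
    unfolding narrow_def by (intro exI[of _ c] exI[of _ "g - c"] exI[of _ x]) auto
qed

lemma narrow_add:
  assumes "narrow Z x m f" "narrow Z x m' f'" and x: "0 \<le> x"
  shows "narrow Z x (m + m') (f + f')"
proof -
  obtain h r w where f: "f = h + r" "poly_in Z h" "wsum Z x w r" "1 + w \<le> (1 + x) ^ m"
    using assms(1) by (auto simp: narrow_def)
  obtain h' r' w' where f': "f' = h' + r'" "poly_in Z h'" "wsum Z x w' r'" "1 + w' \<le> (1 + x) ^ m'"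
    using assms(2) by (auto simp: narrow_def)
  have w: "0 \<le> w" "0 \<le> w'"
    using wsum_nonneg f(3) f'(3) x by blast+
  then have "(1 + w) * (1 + w') \<le> (1 + x) ^ (m + m')"
    unfolding power_add using f(4) f'(4) by (intro mult_mono) auto
  moreover have "1 + (w + w') \<le> (1 + w) * (1 + w')"
    using w by (simp add: algebra_simps)
  ultimately have "1 + (w + w') \<le> (1 + x) ^ (m + m')"
    by linarith
  moreover have "f + f' = (h + h') + (r + r')"
    by (simp add: f f')
  ultimately show ?thesis
    unfolding narrow_def using poly_in_add[OF f(2) f'(2)] wsum_add[OF f(3) f'(3)] by blast
qed

text \<open>Expanding \<open>(h + r) * (h' + r')\<close> leaves, apart from \<open>h * h'\<close>,
  three products of total weight \<open>(1 + w) * (1 + w') - 1\<close>.\<close>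

lemma narrow_mult:
  assumes "narrow Z x m f" "narrow Z x m' f'" and x: "0 \<le> x"
  shows "narrow Z x (m + m') (f * f')"
proof -
  obtain h r w where f: "f = h + r" "poly_in Z h" "wsum Z x w r" "1 + w \<le> (1 + x) ^ m"
    using assms(1) by (auto simp: narrow_def)
  obtain h' r' w' where f': "f' = h' + r'" "poly_in Z h'" "wsum Z x w' r'" "1 + w' \<le> (1 + x) ^ m'"
    using assms(2) by (auto simp: narrow_def)
  have w: "0 \<le> w" "0 \<le> w'"
    using wsum_nonneg f(3) f'(3) x by blast+
  then have "(1 + w) * (1 + w') \<le> (1 + x) ^ (m + m')"
    unfolding power_add using f(4) f'(4) by (intro mult_mono) auto
  then have "1 + (w' + w + w * w') \<le> (1 + x) ^ (m + m')"
    by (simp add: algebra_simps)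
  moreover have "f * f' = h * h' + (h * r' + h' * r + r * r')"
    by (simp add: f f' algebra_simps)
  moreover have "wsum Z x w' (h * r')" "wsum Z x w (h' * r)"
    using wsum_term_mult[OF f'(3) off_ord_1 f(2)] wsum_term_mult[OF f(3) off_ord_1 f'(2)] by simp_all
  ultimately show ?thesis
    unfolding narrow_def
    using poly_in_mult[OF f(2) f'(2)] wsum_add[OF wsum_add wsum_mult[OF f(3) f'(3)]] by blast
qed

lemma narrow_prod:
  assumes "\<And>j. j \<in> A \<Longrightarrow> narrow Z x m (f j)" and x: "0 \<le> x"
  shows "narrow Z x (card A * m) (prod f A)"
  using assms(1)
proof (induction A rule: infinite_finite_induct)
  case (insert j A)
  then show ?case
    using narrow_mult[OF _ _ x, of Z m "f j" "card A * m" "prod f A"] by simp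
qed (auto intro: narrow_poly_in)

text \<open>The split-off summand is \<open>1 * h\<close>, of order 0 and weight
  \<open>x ^ 0\<close>; it accounts for the 1 in \<open>1 + w\<close>.\<close>

lemma narrow_imp_wsum:
  assumes "narrow Z x m f"
  shows "\<exists>w \<le> (1 + x) ^ m. wsum Z x w f"
proof -
  obtain h r w where f: "f = h + r" "poly_in Z h" "wsum Z x w r" "1 + w \<le> (1 + x) ^ m"
    using assms by (auto simp: narrow_def)
  have "wsum Z x 1 h"
    using wsum_single[OF off_ord_1 f(2), of x] by simp
  from wsum_add[OF this f(3)] f show ?thesis by auto
qed

section \<open>Read-once formulas have small weight\<close>

text \<open>
  Along a path of the formula on which no other variable of \<open>Z\<close> joins in, the polynomial stays
  affine in the one at the bottom, with coefficients free of \<open>Z\<close>. Paying only once for the whole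
  path makes the cost linear in the number of \<open>Z\<close>-leaves, independently of depth and size.
\<close>

definition affine_narrow :: "'v set \<Rightarrow> real \<Rightarrow> nat \<Rightarrow> ('v, 'a::comm_ring_1) mpoly \<Rightarrow> bool" where
  "affine_narrow Z x m f \<longleftrightarrow>
    (\<exists>A B g. f = A * g + B \<and> off_ord Z 0 A \<and> off_ord Z 0 B \<and> narrow Z x m g)"

lemma affine_narrow_if_narrow: "narrow Z x m f \<Longrightarrow> affine_narrow Z x m f"
  unfolding affine_narrow_def
  by (intro exI[of _ 1] exI[of _ 0] exI[of _ f]) auto

lemma narrow_if_affine_narrow:
  assumes "affine_narrow Z x m f" "0 \<le> x"
  shows "narrow Z x (m + 2) f"
proof -
  obtain A B g where *: "f = A * g + B" "off_ord Z 0 A" "off_ord Z 0 B" "narrow Z x m g"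
    using assms by (auto simp: affine_narrow_def)
  \<comment> \<open>One unit each for the coefficients \<open>A\<close> and
    \<open>B\<close>.\<close>
  then have "narrow Z x (1 + m + 1) f"
    using assms(2) by (auto intro!: narrow_add narrow_mult narrow_off_ord simp del: One_nat_def)
  then show ?thesis by simp
qed

lemma affine_narrow_add_off_ord:
  assumes "affine_narrow Z x m f" "off_ord Z 0 g"
  shows "affine_narrow Z x m (f + g)" "affine_narrow Z x m (g + f)"
proof -
  show "affine_narrow Z x m (f + g)"
    using assms unfolding affine_narrow_def by (metis add.assoc off_ord_add)
  then show "affine_narrow Z x m (g + f)"
    by (simp add: add.commute)
qed

lemma affine_narrow_mult_off_ord:
  assumes "affine_narrow Z x m f" "off_ord Z 0 g"
  shows "affine_narrow Z x m (g * f)" "affine_narrow Z x m (f * g)"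
proof -
  obtain A B r where f: "f = A * r + B" "off_ord Z 0 A" "off_ord Z 0 B" "narrow Z x m r"
    using assms by (auto simp: affine_narrow_def)
  then have "g * f = (g * A) * r + g * B"
    by (simp add: algebra_simps)
  then show "affine_narrow Z x m (g * f)"
    unfolding affine_narrow_def using off_ord_mult[OF assms(2) f(2)] off_ord_mult[OF assms(2) f(3)] f(4)
    by fastforce
  then show "affine_narrow Z x m (f * g)"
    by (simp add: mult.commute)
qed

text \<open>A gate with \<open>Z\<close>-leaves below only one child keeps the affine form for free.
  A gate where both children have some closes both affine forms at cost 2 each; \<open>r + 1\<close>
  and \<open>r' + 1\<close> leaves then give
  \<open>4 * r + 2 + (4 * r' + 2) = 4 * (r + r' + 1)\<close>, as required for
  \<open>r + r' + 2\<close> leaves.\<close>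

lemma formula_affine_narrow:
  assumes x: "0 \<le> x"
  shows "(length (filter (\<lambda>v. v \<in> Z) (var_leaves F)) = 0 \<longrightarrow> off_ord Z 0 (poly_of F)) \<and>
    (\<forall>r. length (filter (\<lambda>v. v \<in> Z) (var_leaves F)) = Suc r \<longrightarrow> affine_narrow Z x (4 * r) (poly_of F))"
proof (induction F)
  case (Var v)
  then show ?case
    by (auto intro: off_ord_var poly_in_var narrow_poly_in affine_narrow_if_narrow)
next
  case (Const c)
  then show ?case by simp
next
  case (Plus F G)
  let ?n = "\<lambda>F. length (filter (\<lambda>v. v \<in> Z) (var_leaves F))"
  show ?case
  proof (cases "?n F"; cases "?n G")
    fix r r' assume r: "?n F = Suc r" "?n G = Suc r'"
    have "4 * r + 2 + (4 * r' + 2) = 4 * (r + r' + 1)"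
      by simp
    moreover have "narrow Z x (4 * r + 2 + (4 * r' + 2)) (poly_of F + poly_of G)"
      using Plus r x by (intro narrow_add narrow_if_affine_narrow) auto
    ultimately have "affine_narrow Z x (4 * (r + r' + 1)) (poly_of F + poly_of G)"
      by (intro affine_narrow_if_narrow) metis
    then show ?thesis using r by simp
  qed (use Plus in \<open>auto intro: off_ord_add affine_narrow_add_off_ord\<close>)
next
  case (Times F G)
  let ?n = "\<lambda>F. length (filter (\<lambda>v. v \<in> Z) (var_leaves F))"
  show ?case
  proof (cases "?n F"; cases "?n G")
    fix r r' assume r: "?n F = Suc r" "?n G = Suc r'"
    have "4 * r + 2 + (4 * r' + 2) = 4 * (r + r' + 1)"
      by simp
    moreover have "narrow Z x (4 * r + 2 + (4 * r' + 2)) (poly_of F * poly_of G)"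
      using Times r x by (intro narrow_mult narrow_if_affine_narrow) auto
    ultimately have "affine_narrow Z x (4 * (r + r' + 1)) (poly_of F * poly_of G)"
      by (intro affine_narrow_if_narrow) metis
    then show ?thesis using r by simp
  qed (use Times off_ord_mult[of Z 0 "poly_of F" 0] in \<open>auto intro: affine_narrow_mult_off_ord\<close>)
qed

text \<open>Reading each variable at most once bounds the number of \<open>Z\<close>-leaves by
  \<open>card Z\<close>. The summand 1 covers formulas without such leaves.\<close>

lemma narrow_rop:
  assumes f: "is_rop X f" and Z: "finite Z" and x: "0 \<le> x"
  shows "narrow Z x (4 * card Z + 1) f"
proof -
  obtain F where F: "distinct (var_leaves F)" "poly_of F = f"
    using f by (auto simp: is_rop_def rofs_def)
  let ?l = "filter (\<lambda>v. v \<in> Z) (var_leaves F)"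
  have "length ?l = card (set ?l)"
    using F(1) by (intro distinct_card[symmetric]) auto
  also have "\<dots> \<le> card Z"
    using Z by (intro card_mono) auto
  finally have le: "length ?l \<le> card Z" .
  show ?thesis
  proof (cases "length ?l")
    case 0
    then have "narrow Z x 1 f"
      using formula_affine_narrow[OF x, of Z F] F(2) narrow_off_ord by auto
    then show ?thesis
      by (rule narrow_mono) (use x in auto)
  next
    case (Suc r)
    then have "narrow Z x (4 * r + 2) f"
      using formula_affine_narrow[OF x, of Z F] F(2) narrow_if_affine_narrow[OF _ x] by auto
    then show ?thesis
      by (rule narrow_mono) (use x le Suc in auto)
  qed
qed

section \<open>Permutation monomials and the coefficients of the permanent\<close>

text \<open>The exponent vector of the product of the variables \<open>(i, p i)\<close>. Allowing a
  set \<open>A\<close> of rows makes it possible to cut a permutation monomial into two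
  parts.\<close>

definition graph_mon :: "'b set \<Rightarrow> ('b \<Rightarrow> 'c) \<Rightarrow> ('b \<times> 'c \<Rightarrow>\<^sub>0 nat)" where
  "graph_mon A p = (\<Sum>i\<in>A. Poly_Mapping.single (i, p i) 1)"

lemma lookup_graph_mon:
  assumes "finite A"
  shows "lookup (graph_mon A p) (i, j) = (if i \<in> A \<and> p i = j then 1 else 0)"
proof -
  have "lookup (graph_mon A p) (i, j) = (\<Sum>l\<in>A. if l = i then (if p i = j then 1 else 0) else 0)"
    unfolding graph_mon_def lookup_sum
    by (intro sum.cong) (auto simp: lookup_single when_def)
  then show ?thesis using assms by auto
qed

lemma keys_graph_mon: "finite A \<Longrightarrow> keys (graph_mon A p) = (\<lambda>i. (i, p i)) ` A"
  by (auto simp: in_keys_iff lookup_graph_mon split: if_splits)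

lemma mdeg_graph_mon: "mdeg (graph_mon A p) = card A"
  by (simp add: graph_mon_def mdeg_sum)

lemma graph_mon_Un:
  "finite A \<Longrightarrow> B \<subseteq> A \<Longrightarrow> graph_mon B p + graph_mon (A - B) p = graph_mon A p"
  by (simp add: graph_mon_def sum.subset_diff[of B A] add.commute)

lemma graph_mon_permutes_eq_iff:
  assumes "finite A" "p permutes A" "q permutes A"
  shows "graph_mon A p = graph_mon A q \<longleftrightarrow> p = q"
proof
  assume eq: "graph_mon A p = graph_mon A q"
  show "p = q"
  proof
    fix i show "p i = q i"
    proof (cases "i \<in> A")
      case True
      have "lookup (graph_mon A p) (i, q i) = lookup (graph_mon A q) (i, q i)"
        by (simp only: eq)
      then show ?thesis
        using True by (simp add: lookup_graph_mon assms(1) split: if_splits)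
    next
      case False
      then show ?thesis
        by (simp add: permutes_not_in[OF assms(2)] permutes_not_in[OF assms(3)])
    qed
  qed
qed simp

lemma permanent_poly_conv_graph_mon:
  "permanent_poly n = (\<Sum>p | p permutes {1..n}. Poly_Mapping.single (graph_mon {1..n} p) 1)"
proof -
  have "(\<Prod>i\<in>A. mp_var (i, p i)) = Poly_Mapping.single (graph_mon A p) (1 :: 'a)"
    for A :: "nat set" and p :: "nat \<Rightarrow> nat"
    by (induction A rule: infinite_finite_induct)
       (simp_all add: graph_mon_def mp_var_def mult_single)
  then show ?thesis
    by (simp add: permanent_poly_def)
qed

text \<open>Different permutations have different monomials, so no coefficient accumulates and the
  values are 0 and 1 in any characteristic.\<close>

lemma lookup_permanent_poly:
  "lookup (permanent_poly n :: (nat \<times> nat, 'a::comm_ring_1) mpoly) m =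
    (if \<exists>p. p permutes {1..n} \<and> m = graph_mon {1..n} p then 1 else 0)"
proof (cases "\<exists>p. p permutes {1..n} \<and> m = graph_mon {1..n} p")
  case True
  then obtain p where p: "p permutes {1..n}" "m = graph_mon {1..n} p"
    by blast
  have "lookup (permanent_poly n :: (nat \<times> nat, 'a) mpoly) m =
      (\<Sum>q | q permutes {1..n}. if q = p then 1 else 0)"
    unfolding permanent_poly_conv_graph_mon lookup_sum p(2)
    by (intro sum.cong) (auto simp: lookup_single when_def graph_mon_permutes_eq_iff[OF finite_atLeastAtMost _ p(1)]
        simp del: One_nat_def)
  then show ?thesis
    using True p(1) by (simp add: finite_permutations)
next
  case False
  then show ?thesis
    unfolding permanent_poly_conv_graph_mon lookup_sum
    by (auto simp: lookup_single when_def intro!: sum.neutral)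
qed

text \<open>
  The \<open>Y\<close>-part of one permutation monomial and the \<open>Z\<close>-part of another multiply to a permutation
  monomial only if their rows and columns fit together.
\<close>

lemma graph_mon_glue:
  assumes fin: "finite A" and R: "R \<subseteq> A" "R' \<subseteq> A"
    and perm: "\<pi> permutes A" "\<pi>' permutes A" "\<sigma> permutes A"
    and eq: "graph_mon R \<pi> + graph_mon (A - R') \<pi>' = graph_mon A \<sigma>"
  shows "R \<subseteq> R' \<and> \<pi> ` R \<subseteq> \<pi>' ` R'"
proof -
  have finR: "finite R" "finite (A - R')"
    using fin R by (auto intro: finite_subset)
  have lk: "(if i \<in> R \<and> \<pi> i = j then 1 else 0) + (if i \<in> A - R' \<and> \<pi>' i = j then 1 else 0) =
      (if i \<in> A \<and> \<sigma> i = j then 1 else (0::nat))" for i j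
    using arg_cong[OF eq, of "\<lambda>m. lookup m (i, j)"] by (simp add: lookup_add lookup_graph_mon finR fin)
  have L: "\<sigma> i = \<pi> i" if "i \<in> R" for i
    using lk[of i "\<pi> i"] that by (auto split: if_splits)
  have L': "\<sigma> i = \<pi>' i" if "i \<in> A" "i \<notin> R'" for i
    using lk[of i "\<pi>' i"] that by (auto split: if_splits)
  \<comment> \<open>Otherwise both parts contain the cell \<open>(i, \<sigma> i)\<close>, which
    would get exponent 2.\<close>
  have sub: "i \<in> R'" if i: "i \<in> R" for i
  proof (rule ccontr)
    assume "i \<notin> R'"
    then have "\<pi>' i = \<pi> i"
      using L[OF i] L'[of i] R i by auto
    then show False
      using lk[of i "\<pi> i"] i R \<open>i \<notin> R'\<close> by (auto split: if_splits)
  qed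
  \<comment> \<open>Otherwise the second part uses column \<open>\<pi> i\<close> in a row outside
    \<open>R'\<close>, so \<open>\<sigma>\<close> takes the same value in two rows.\<close>
  moreover have "\<pi> i \<in> \<pi>' ` R'" if i: "i \<in> R" for i
  proof (rule ccontr)
    assume not: "\<pi> i \<notin> \<pi>' ` R'"
    have "\<pi> i \<in> A"
      using i R perm(1) permutes_in_image by fastforce
    then obtain i' where i': "i' \<in> A" "\<pi>' i' = \<pi> i"
      using permutes_image[OF perm(2)] by (metis imageE)
    then have "i' \<notin> R'"
      using not by force
    then have "\<sigma> i' = \<sigma> i"
      using L[OF i] L'[OF i'(1)] i' by simp
    then have "i' = i"
      using permutes_inj[OF perm(3)] by (auto dest: injD)
    then show False
      using sub[OF i] \<open>i' \<notin> R'\<close> by simp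
  qed
  ultimately show ?thesis by auto
qed

section \<open>An identity submatrix for the permanent\<close>

text \<open>Induction composes with one more cycle on fresh points. The clause on fixed points
  ensures that the earlier cycles leave these alone.\<close>

lemma ex_three_cycles:
  fixes P Q H :: "nat \<Rightarrow> 'b"
  assumes "inj_on P {..<k}" "inj_on Q {..<k}" "inj_on H {..<k}"
    and "P ` {..<k} \<inter> Q ` {..<k} = {}" "P ` {..<k} \<inter> H ` {..<k} = {}" "Q ` {..<k} \<inter> H ` {..<k} = {}"
    and "P ` {..<k} \<subseteq> S" "Q ` {..<k} \<subseteq> S" "H ` {..<k} \<subseteq> S"
  shows "\<exists>\<pi>. \<pi> permutes S \<and> (\<forall>j<k. \<pi> (P j) = Q j \<and> \<pi> (Q j) = H j \<and> \<pi> (H j) = P j) \<and>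
    (\<forall>x. x \<notin> P ` {..<k} \<union> Q ` {..<k} \<union> H ` {..<k} \<longrightarrow> \<pi> x = x)"
  using assms
proof (induction k)
  case 0
  then show ?case using permutes_id[of S] by (intro exI[of _ "\<lambda>x. x"]) (auto simp: id_def)
next
  case (Suc k)
  have "\<exists>\<pi>. \<pi> permutes S \<and> (\<forall>j<k. \<pi> (P j) = Q j \<and> \<pi> (Q j) = H j \<and> \<pi> (H j) = P j) \<and>
    (\<forall>x. x \<notin> P ` {..<k} \<union> Q ` {..<k} \<union> H ` {..<k} \<longrightarrow> \<pi> x = x)"
    using Suc.prems by (intro Suc.IH) (auto simp: lessThan_Suc)
  then obtain \<pi> where \<pi>: "\<pi> permutes S" "\<And>j. j < k \<Longrightarrow> \<pi> (P j) = Q j \<and> \<pi> (Q j) = H j \<and> \<pi> (H j) = P j"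
    and fix_\<pi>': "\<And>x. x \<notin> P ` {..<k} \<union> Q ` {..<k} \<union> H ` {..<k} \<Longrightarrow> \<pi> x = x"
    by blast
  define U where "U = P ` {..<k} \<union> Q ` {..<k} \<union> H ` {..<k}"
  have fix_\<pi>: "\<pi> x = x" if "x \<notin> U" for x
    using fix_\<pi>' that by (simp add: U_def)
  define c where "c = transpose (P k) (Q k) \<circ> transpose (Q k) (H k)"
  have fix_c: "c x = x" if "x \<noteq> P k" "x \<noteq> Q k" "x \<noteq> H k" for x
    using that by (simp add: c_def transpose_def)
  have new: "P k \<notin> U" "Q k \<notin> U" "H k \<notin> U" and ne: "P k \<noteq> Q k" "P k \<noteq> H k" "Q k \<noteq> H k"
    using Suc.prems by (auto simp: U_def lessThan_Suc)
  have "\<pi> \<circ> c permutes S"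
    unfolding c_def using Suc.prems \<pi>(1)
    by (intro permutes_compose permutes_swap_id) auto
  moreover have "(\<pi> \<circ> c) (P j) = Q j \<and> (\<pi> \<circ> c) (Q j) = H j \<and> (\<pi> \<circ> c) (H j) = P j"
    if "j < Suc k" for j
  proof (cases "j = k")
    case True
    have "c (P k) = Q k" "c (Q k) = H k" "c (H k) = P k"
      using ne by (simp_all add: c_def transpose_def)
    then show ?thesis
      using True new fix_\<pi> by simp
  next
    case False
    then have j: "j < k" using that by simp
    have "P j \<in> U" "Q j \<in> U" "H j \<in> U"
      using j by (simp_all add: U_def)
    then have "c (P j) = P j" "c (Q j) = Q j" "c (H j) = H j"
      using new fix_c by metis+
    then show ?thesis
      using \<pi>(2)[OF j] by simp
  qed
  moreover have "(\<pi> \<circ> c) x = x" if "x \<notin> P ` {..<Suc k} \<union> Q ` {..<Suc k} \<union> H ` {..<Suc k}" for x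
  proof -
    have "x \<notin> U" "x \<noteq> P k" "x \<noteq> Q k" "x \<noteq> H k"
      using that by (auto simp: U_def lessThan_Suc)
    then show ?thesis using fix_c fix_\<pi> by simp
  qed
  ultimately show ?case by blast
qed

text \<open>
  Index \<open>(c, d)\<close> stands for the product of the three-cycles \<open>P c j \<rightarrow> Q d j \<rightarrow> j + 1 \<rightarrow> P c j\<close> for
  \<open>j < k\<close>. The cell \<open>(P c j, Q d j)\<close> is the only one of its cycle outside \<open>Z\<close>. Routing the cycles
  through the \<open>k\<close> hubs \<open>1, \<dots>, k\<close> keeps \<open>Z\<close> of linear size, although \<open>b\<^sup>2\<close> cells compete for each \<open>j\<close>.
\<close>

lemma permanent_identity_submatrix:
  assumes k: "0 < k" and n: "k * (2 * b + 1) \<le> n"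
  shows "\<exists>Z (I :: ((nat \<Rightarrow> nat) \<times> (nat \<Rightarrow> nat)) set) \<alpha> \<beta>.
    finite Z \<and> card Z \<le> 3 * n \<and> finite I \<and> card I = b ^ (2 * k) \<and>
    (\<forall>i\<in>I. keys (\<alpha> i) \<inter> Z = {} \<and> mdeg (\<alpha> i) = k \<and> keys (\<beta> i) \<subseteq> Z) \<and>
    (\<forall>i\<in>I. \<forall>j\<in>I. lookup (permanent_poly n :: (nat \<times> nat, 'a::comm_ring_1) mpoly) (\<alpha> i + \<beta> j) =
      (if i = j then 1 else 0))"
proof -
  define A where "A = {1..n}"
  \<comment> \<open>The representative of \<open>x\<close> modulo \<open>k\<close> in
    \<open>{1..k}\<close>. Block 0 of length \<open>k\<close> holds the hubs, the next
    \<open>b\<close> blocks the values of \<open>P\<close>, the last \<open>b\<close> those of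
    \<open>Q\<close>, whence \<open>k * (2 * b + 1) \<le> n\<close>. Both \<open>P c j\<close> and
    \<open>Q d j\<close> have hub \<open>j + 1\<close>.\<close>
  define hub where "hub x = (x - 1) mod k + 1" for x
  define P where "P c j = k * (1 + c j) + j + 1" for c :: "nat \<Rightarrow> nat" and j
  define Q where "Q d j = k * (1 + b + d j) + j + 1" for d :: "nat \<Rightarrow> nat" and j
  \<comment> \<open>The cells of fixed points, of steps from \<open>Q\<close> to the hub, and of
    steps from the hub to \<open>P\<close>.\<close>
  define Z where "Z = (\<lambda>x. (x, x)) ` A \<union> (\<lambda>x. (x, hub x)) ` A \<union> (\<lambda>x. (hub x, x)) ` A"
  define C where "C = ({..<k} \<rightarrow>\<^sub>E {..<b})"
  define K where "K = {..<k}"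
  have finA: "finite A" by (simp add: A_def)
  have finZ: "finite Z" by (simp add: Z_def finA)
  have cardZ: "card Z \<le> 3 * n"
  proof -
    have "card Z \<le> card ((\<lambda>x. (x, x)) ` A) + card ((\<lambda>x. (x, hub x)) ` A) + card ((\<lambda>x. (hub x, x)) ` A)"
      unfolding Z_def by (meson add_le_mono card_Un_le order_trans order_refl)
    also have "\<dots> \<le> card A + card A + card A"
      by (intro add_mono card_image_le finA)
    finally show ?thesis by (simp add: A_def)
  qed
  have finC: "finite C" by (simp add: C_def finite_PiE)
  have cardC: "card C = b ^ k" by (simp add: C_def card_PiE)
  have code: "k * x + j = k * y + j' \<longleftrightarrow> x = y \<and> j = j'" if "j < k" "j' < k" for x y j j'
    using that k by (metis div_mult_self4 div_less add_left_cancel add.commute less_numeral_extra(3))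
  have hub: "hub (k * x + j + 1) = j + 1" if "j < k" for x j
    using that by (simp add: hub_def)
  have cb: "c j < b" if "c \<in> C" "j < k" for c j
    using that by (auto simp: C_def)
  have bound: "k * x + j + 1 \<in> A" if "x \<le> 2 * b" "j < k" for x j
  proof -
    have "k * x + j + 1 \<le> k * (2 * b) + k"
      using that by (intro order_trans[OF _ add_mono[OF mult_le_mono2[OF that(1)] order_refl]]) auto
    then show ?thesis using n by (simp add: A_def algebra_simps)
  qed
  have PA: "P c j \<in> A" and QA: "Q c j \<in> A" if "c \<in> C" "j < k" for c j
    unfolding P_def Q_def
    using cb[OF that] that bound[of "1 + c j" j] bound[of "1 + b + c j" j] by simp_all
  have P_eq: "P c j = P c' j' \<longleftrightarrow> c j = c' j' \<and> j = j'" if "j < k" "j' < k" for c c' j j'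
    using code[OF that, of "1 + c j" "1 + c' j'"] by (simp add: P_def)
  have Q_eq: "Q c j = Q c' j' \<longleftrightarrow> c j = c' j' \<and> j = j'" if "j < k" "j' < k" for c c' j j'
    using code[OF that, of "1 + b + c j" "1 + b + c' j'"] by (simp add: Q_def)
  have PQ: "P c j \<noteq> Q d j'" if "c \<in> C" "j < k" "j' < k" for c d j j'
    using code[OF that(2,3), of "1 + c j" "1 + b + d j'"] cb[OF that(1,2)] by (simp add: P_def Q_def)
  have P_big: "k < P c j" and Q_big: "k < Q c j" for c j
    by (simp_all add: P_def Q_def algebra_simps)
  have hubP: "hub (P c j) = j + 1" and hubQ: "hub (Q c j) = j + 1" if "j < k" for c j
    unfolding P_def Q_def by (rule hub[OF that])+
  have hub_le: "hub x \<le> k" for x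
    using k by (simp add: hub_def Suc_le_eq)
  define cyc where "cyc c d \<pi> \<longleftrightarrow> \<pi> permutes A \<and>
    (\<forall>j<k. \<pi> (P c j) = Q d j \<and> \<pi> (Q d j) = j + 1 \<and> \<pi> (j + 1) = P c j) \<and>
    (\<forall>x. x \<notin> P c ` {..<k} \<union> Q d ` {..<k} \<union> (\<lambda>j. j + 1) ` {..<k} \<longrightarrow> \<pi> x = x)" for c d \<pi>
  have ex_cyc: "\<exists>\<pi>. cyc c d \<pi>" if c: "c \<in> C" and d: "d \<in> C" for c d
    unfolding cyc_def
  proof (rule ex_three_cycles)
    show "inj_on (P c) {..<k}" "inj_on (Q d) {..<k}" "inj_on (\<lambda>j. j + 1) {..<k}"
      by (auto simp: inj_on_def P_eq Q_eq)
    show "P c ` {..<k} \<inter> Q d ` {..<k} = {}"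
      using PQ[OF c] by auto
    have "P c j \<noteq> i + 1" "Q d j \<noteq> i + 1" if "i < k" for i j
      using P_big[of c j] Q_big[of d j] that by auto
    then show "P c ` {..<k} \<inter> (\<lambda>j. j + 1) ` {..<k} = {}"
      "Q d ` {..<k} \<inter> (\<lambda>j. j + 1) ` {..<k} = {}"
      by auto
    show "P c ` {..<k} \<subseteq> A" "Q d ` {..<k} \<subseteq> A"
      using PA[OF c] QA[OF d] by auto
    show "(\<lambda>j. j + 1) ` {..<k} \<subseteq> A"
      using bound[of 0] by auto
  qed
  define \<pi> where "\<pi> c d = (SOME \<pi>. cyc c d \<pi>)" for c d
  have cyc: "cyc c d (\<pi> c d)" if "c \<in> C" "d \<in> C" for c d
    unfolding \<pi>_def by (rule someI_ex[OF ex_cyc[OF that]])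
  have perm: "\<pi> c d permutes A" if "c \<in> C" "d \<in> C" for c d
    using cyc[OF that] by (simp add: cyc_def)
  have \<pi>: "\<pi> c d (P c j) = Q d j \<and> \<pi> c d (Q d j) = j + 1 \<and> \<pi> c d (j + 1) = P c j"
    if "c \<in> C" "d \<in> C" "j < k" for c d j
    using cyc[OF that(1,2)] that(3) by (simp add: cyc_def)
  have fix_\<pi>: "\<pi> c d x = x"
    if "c \<in> C" "d \<in> C" "x \<notin> P c ` {..<k} \<union> Q d ` {..<k} \<union> (\<lambda>j. j + 1) ` {..<k}" for c d x
    using cyc[OF that(1,2)] that(3) unfolding cyc_def by blast
  define \<alpha> where "\<alpha> = (\<lambda>(c, d). graph_mon (P c ` K) (\<pi> c d))"
  define \<beta> where "\<beta> = (\<lambda>(c, d). graph_mon (A - P c ` K) (\<pi> c d))"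
  have finK: "finite K" by (simp add: K_def)
  have \<alpha>: "keys (\<alpha> (c, d)) \<inter> Z = {} \<and> mdeg (\<alpha> (c, d)) = k" if c: "c \<in> C" and d: "d \<in> C" for c d
  proof
    have "inj_on (P c) K"
      by (auto simp: inj_on_def K_def P_eq)
    then show "mdeg (\<alpha> (c, d)) = k"
      by (simp add: \<alpha>_def mdeg_graph_mon card_image K_def)
    have "(P c j, \<pi> c d (P c j)) \<notin> Z" if j: "j < k" for j
    proof -
      \<comment> \<open>Neither coordinate of the cell is a hub, and it is off the diagonal because
        \<open>P\<close> and \<open>Q\<close> use disjoint blocks.\<close>
      have "P c j \<noteq> hub x" "Q d j \<noteq> hub x" for x
        using P_big[of c j] Q_big[of d j] hub_le[of x] by auto
      then show ?thesis
        using \<pi>[OF c d j] PQ[OF c j j, of d] by (auto simp: Z_def)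
    qed
    then show "keys (\<alpha> (c, d)) \<inter> Z = {}"
      by (auto simp: \<alpha>_def keys_graph_mon finK K_def)
  qed
  have \<beta>: "keys (\<beta> (c, d)) \<subseteq> Z" if c: "c \<in> C" and d: "d \<in> C" for c d
  proof -
    have "(x, \<pi> c d x) \<in> Z" if x: "x \<in> A" "x \<notin> P c ` K" for x
    proof -
      consider j where "j < k" "x = Q d j" | j where "j < k" "x = j + 1" | "\<pi> c d x = x"
        using fix_\<pi>[OF c d, of x] x(2) by (auto simp: K_def)
      then show ?thesis
      proof cases
        case (1 j)
        then have "(x, \<pi> c d x) = (x, hub x)"
          using \<pi>[OF c d, of j] hubQ[of j d] by simp
        then show ?thesis using x by (auto simp: Z_def)
      next
        case (2 j)
        then have "(x, \<pi> c d x) = (hub (P c j), P c j)"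
          using \<pi>[OF c d, of j] hubP[of j c] by simp
        then show ?thesis using PA[OF c 2(1)] by (auto simp: Z_def)
      next
        case 3
        then show ?thesis using x by (auto simp: Z_def)
      qed
    qed
    then show ?thesis
      by (auto simp: \<beta>_def keys_graph_mon finA)
  qed
  have "lookup (permanent_poly n :: (nat \<times> nat, 'a) mpoly) (\<alpha> (c, d) + \<beta> (c', d')) =
      (if (c, d) = (c', d') then 1 else 0)"
    if c: "c \<in> C" "d \<in> C" "c' \<in> C" "d' \<in> C" for c d c' d'
  proof -
    have PK: "P c ` K \<subseteq> A" if "c \<in> C" for c
      using PA[OF that] by (auto simp: K_def)
    have image: "\<pi> c d ` P c ` K = Q d ` K" if "c \<in> C" "d \<in> C" for c d
      unfolding image_image by (rule image_cong) (use \<pi>[OF that] in \<open>auto simp: K_def\<close>)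
    have "(\<exists>\<sigma>. \<sigma> permutes A \<and> \<alpha> (c, d) + \<beta> (c', d') = graph_mon A \<sigma>) \<longleftrightarrow> c = c' \<and> d = d'"
    proof
      assume "\<exists>\<sigma>. \<sigma> permutes A \<and> \<alpha> (c, d) + \<beta> (c', d') = graph_mon A \<sigma>"
      then obtain \<sigma> where \<sigma>: "\<sigma> permutes A"
        "graph_mon (P c ` K) (\<pi> c d) + graph_mon (A - P c' ` K) (\<pi> c' d') = graph_mon A \<sigma>"
        by (auto simp: \<alpha>_def \<beta>_def)
      have "P c ` K \<subseteq> P c' ` K \<and> \<pi> c d ` P c ` K \<subseteq> \<pi> c' d' ` P c' ` K"
        using graph_mon_glue[OF finA PK[OF c(1)] PK[OF c(3)] perm[OF c(1,2)] perm[OF c(3,4)] \<sigma>] .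
      then have sub: "P c ` K \<subseteq> P c' ` K" "Q d ` K \<subseteq> Q d' ` K"
        using image c by auto
      \<comment> \<open>The residue modulo \<open>k\<close> reveals the position \<open>j\<close>,
        so the set of values of \<open>P c\<close> determines \<open>c\<close>, and likewise for
        \<open>Q d\<close>.\<close>
      have "c j = c' j" "d j = d' j" if j: "j < k" for j
      proof -
        obtain i where i: "i < k" "P c j = P c' i"
          using sub(1) j by (auto simp: K_def)
        then show "c j = c' j" using P_eq[OF j i(1)] by auto
        obtain l where l: "l < k" "Q d j = Q d' l"
          using sub(2) j by (auto simp: K_def)
        then show "d j = d' j" using Q_eq[OF j l(1)] by auto
      qed
      then show "c = c' \<and> d = d'"
        using PiE_ext[OF c(1,3)[unfolded C_def]] PiE_ext[OF c(2,4)[unfolded C_def]] by simp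
    next
      assume "c = c' \<and> d = d'"
      then show "\<exists>\<sigma>. \<sigma> permutes A \<and> \<alpha> (c, d) + \<beta> (c', d') = graph_mon A \<sigma>"
        using graph_mon_Un[OF finA PK[OF c(1)]] perm[OF c(1,2)]
        by (intro exI[of _ "\<pi> c d"]) (simp add: \<alpha>_def \<beta>_def)
    qed
    then show ?thesis
      by (simp add: lookup_permanent_poly A_def)
  qed
  moreover have "card (C \<times> C) = b ^ (2 * k)"
    by (simp add: card_cartesian_product cardC mult_2 power_add)
  ultimately show ?thesis
    using finZ cardZ finC \<alpha> \<beta>
    by (intro exI[of _ Z] exI[of _ "C \<times> C"] exI[of _ \<alpha>] exI[of _ \<beta>]) simp
qed

section \<open>Lower bound on the number of summands\<close>

text \<open>Each product has weight at most 3, so the sum has rank at most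
  \<open>3 * s * D ^ k\<close> on rows of degree \<open>k\<close>, while the identity submatrix has
  size \<open>b ^ (2 * k)\<close>.\<close>

lemma sum_prod_rop_lower_bound:
  fixes f :: "nat \<Rightarrow> nat \<Rightarrow> (nat \<times> nat, 'a::field) mpoly"
  assumes rop: "\<And>i j. i \<in> {1..s} \<Longrightarrow> j \<in> {1..t} \<Longrightarrow> is_rop X (f i j)"
    and eq: "(\<Sum>i = 1..s. \<Prod>j = 1..t. f i j) = permanent_poly n"
    and t: "1 \<le> t" and k: "0 < k" and n: "k * (2 * b + 1) \<le> n"
  shows "real (b ^ (2 * k)) \<le> 3 * real s * real (t * (12 * n + 1)) ^ k"
proof -
  obtain Z and I :: "((nat \<Rightarrow> nat) \<times> (nat \<Rightarrow> nat)) set" and \<alpha> \<beta> where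
    Z: "finite Z" "card Z \<le> 3 * n" and I: "finite I" "card I = b ^ (2 * k)"
    and \<alpha>: "\<And>i. i \<in> I \<Longrightarrow> keys (\<alpha> i) \<inter> Z = {} \<and> mdeg (\<alpha> i) = k"
    and \<beta>: "\<And>i. i \<in> I \<Longrightarrow> keys (\<beta> i) \<subseteq> Z"
    and id: "\<And>i j. i \<in> I \<Longrightarrow> j \<in> I \<Longrightarrow>
      lookup (permanent_poly n :: (nat \<times> nat, 'a) mpoly) (\<alpha> i + \<beta> j) = (if i = j then 1 else 0)"
    using permanent_identity_submatrix[OF k n, where 'a = 'a] by blast
  define D where "D = t * (12 * n + 1)"
  \<comment> \<open>This keeps \<open>(1 + x) ^ D\<close> below \<open>exp 1\<close>, while division
    by \<open>x ^ k\<close> costs a factor \<open>D ^ k\<close>.\<close>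
  define x where "x = 1 / real D"
  have D: "1 \<le> D" using t by (simp add: D_def)
  then have x: "0 < x" "x \<le> 1" by (auto simp: x_def)
  have weight: "(1 + x) ^ D \<le> 3"
  proof -
    have "(1 + x) ^ D \<le> exp x ^ D"
      using x by (intro power_mono exp_ge_add_one_self) auto
    also have "\<dots> = exp 1"
      using D by (simp add: x_def flip: exp_of_nat_mult)
    also have "\<dots> \<le> 3" by (rule exp_le)
    finally show ?thesis .
  qed
  have "\<exists>w \<le> 3. wsum Z x w (\<Prod>j = 1..t. f i j)" if i: "i \<in> {1..s}" for i
  proof -
    have "narrow Z x (12 * n + 1) (f i j)" if j: "j \<in> {1..t}" for j
      using narrow_rop[OF rop[OF i j] Z(1), of x] Z(2) x by (auto intro: narrow_mono)
    then have "narrow Z x (card {1..t} * (12 * n + 1)) (prod (f i) {1..t})"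
      using x by (intro narrow_prod) auto
    then have "narrow Z x D (prod (f i) {1..t})"
      by (simp add: D_def)
    from narrow_imp_wsum[OF this] obtain w
      where "w \<le> (1 + x) ^ D" "wsum Z x w (prod (f i) {1..t})"
      by blast
    with weight show ?thesis
      by (intro exI[of _ w]) auto
  qed
  then obtain w where w: "\<And>i. i \<in> {1..s} \<Longrightarrow> w i \<le> 3 \<and> wsum Z x (w i) (\<Prod>j = 1..t. f i j)"
    by metis
  then have "wsum Z x (\<Sum>i = 1..s. w i) (permanent_poly n :: (nat \<times> nat, 'a) mpoly)"
    unfolding eq[symmetric] by (intro wsum_sum) auto
  then have "\<exists>q u v. real q * x ^ k \<le> (\<Sum>i = 1..s. w i) \<and> (\<forall>i\<in>I. \<forall>j\<in>I.
      lookup (permanent_poly n :: (nat \<times> nat, 'a) mpoly) (\<alpha> i + \<beta> j) = (\<Sum>l<q. u l i * v l j))"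
    by (rule wsum_coeff_rank[OF _ x]) (use \<alpha> \<beta> in auto)
  then obtain q and u v :: "nat \<Rightarrow> (nat \<Rightarrow> nat) \<times> (nat \<Rightarrow> nat) \<Rightarrow> 'a" where
    q: "real q * x ^ k \<le> (\<Sum>i = 1..s. w i)"
    and uv: "\<forall>i\<in>I. \<forall>j\<in>I.
      lookup (permanent_poly n :: (nat \<times> nat, 'a) mpoly) (\<alpha> i + \<beta> j) = (\<Sum>l<q. u l i * v l j)"
    by blast
  have "card I \<le> q"
  proof (rule rank_one_sum_identity[OF I(1)])
    show "(\<Sum>l<q. u l i * v l j) = (if i = j then 1 else 0)" if "i \<in> I" "j \<in> I" for i j
      using uv that id[OF that] by simp
  qed
  then have "real (b ^ (2 * k)) \<le> real q"
    using I(2) by simp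
  also have "real q = real q * x ^ k * real D ^ k"
    using D by (simp add: x_def power_one_over)
  also have "\<dots> \<le> (\<Sum>i = 1..s. w i) * real D ^ k"
    using q by (intro mult_right_mono) auto
  also have "(\<Sum>i = 1..s. w i) \<le> (\<Sum>i = 1..s. 3)"
    using w by (intro sum_mono) auto
  finally show ?thesis
    by (simp add: D_def mult_right_mono mult.commute)
qed

section \<open>Choice of parameters\<close>

theorem theorem3:
  shows "\<exists>\<epsilon>::real. \<exists>c::real. \<exists>n0::nat. \<epsilon> > 0 \<and> c > 0 \<and>
    (\<forall>n \<ge> n0. \<forall>lam::real. \<forall>s t::nat. \<forall>f :: nat \<Rightarrow> nat \<Rightarrow> (nat \<times> nat, 'a::field) mpoly.
      let N = real (n ^ 2); X = {1..n} \<times> {1..n} in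
      lam \<le> 1 / 30 \<longrightarrow> s \<ge> 1 \<longrightarrow> t \<ge> 1 \<longrightarrow> real t \<le> N powr (1 / 30) \<longrightarrow>
      (\<forall>i \<in> {1..s}. \<forall>j \<in> {1..t}.
         is_rop X (f i j) \<and> real (s_rop X (f i j)) \<le> N powr (1 / 2 + lam)) \<longrightarrow>
      (\<Sum>i = 1..s. \<Prod>j = 1..t. f i j) = permanent_poly n \<longrightarrow>
      real s \<ge> 2 powr (c * N powr \<epsilon>))"
proof -
  \<comment> \<open>For \<open>k\<close> near \<open>n powr (1 / 5)\<close> and \<open>b\<close>
    near \<open>n powr (7 / 10)\<close>, the blocks need order \<open>n powr (9 / 10)\<close>, and
    the square of \<open>b\<close> has order \<open>n powr (7 / 5)\<close>, against
    \<open>n powr (16 / 15)\<close> for \<open>D\<close>. The bound on \<open>t\<close> is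
    \<open>n powr (1 / 15)\<close> because \<open>N\<close> is the square of
    \<open>n\<close>.\<close>
  have "\<forall>\<^sub>F n in sequentially. 2 \<le> real n powr (1 / 5) \<and>
      real n powr (1 / 5) * (2 * real n powr (7 / 10) + 1) \<le> real n \<and>
      1 \<le> real n powr (7 / 10) \<and>
      6 * (real n powr (1 / 15) * (12 * real n + 1)) \<le> (real n powr (7 / 10) - 1)\<^sup>2"
    by (intro eventually_conj; real_asymp)
  then obtain n0 where n0: "\<And>n. n0 \<le> n \<Longrightarrow> 2 \<le> real n powr (1 / 5) \<and>
      real n powr (1 / 5) * (2 * real n powr (7 / 10) + 1) \<le> real n \<and>
      1 \<le> real n powr (7 / 10) \<and>
      6 * (real n powr (1 / 15) * (12 * real n + 1)) \<le> (real n powr (7 / 10) - 1)\<^sup>2"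
    by (auto simp: eventually_sequentially)
  \<comment> \<open>\<open>N powr (1 / 10)\<close> equals \<open>n powr (1 / 5)\<close>, and
    \<open>k\<close> is at least half of it; this yields the exponent 1/10 and the constant
    1/2.\<close>
  have bound: "2 powr (1 / 2 * real (n\<^sup>2) powr (1 / 10)) \<le> real s"
    if n: "n0 \<le> n" and t: "1 \<le> t" "real t \<le> real (n\<^sup>2) powr (1 / 30)"
      and rop: "\<And>i j. i \<in> {1..s} \<Longrightarrow> j \<in> {1..t} \<Longrightarrow> is_rop X (f i j)"
      and eq: "(\<Sum>i = 1..s. \<Prod>j = 1..t. f i j) = permanent_poly n"
    for n s t X and f :: "nat \<Rightarrow> nat \<Rightarrow> (nat \<times> nat, 'a) mpoly"
  proof -
    define k where "k = nat \<lfloor>real n powr (1 / 5)\<rfloor>"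
    define b where "b = nat \<lfloor>real n powr (7 / 10)\<rfloor>"
    define D where "D = t * (12 * n + 1)"
    note large = n0[OF n]
    \<comment> \<open>As \<open>0 powr e = 0\<close>, the case \<open>n = 0\<close> contradicts
      \<open>2 \<le> real n powr (1 / 5)\<close>.\<close>
    have "0 < real n"
      using large by (cases n) auto
    then have "real (n\<^sup>2) = real n powr 2"
      by (simp add: powr_numeral)
    then have sq: "real (n\<^sup>2) powr e = real n powr (2 * e)" for e
      by (simp only: powr_powr)
    have k: "real n powr (1 / 5) / 2 \<le> real k" "real k \<le> real n powr (1 / 5)"
      using large unfolding k_def by linarith+
    have b: "real n powr (7 / 10) - 1 \<le> real b" "real b \<le> real n powr (7 / 10)"
      using large unfolding b_def by linarith+
    have k_pos: "0 < k"
      using k(1) large by (cases k) auto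
    have "real (k * (2 * b + 1)) \<le> real n powr (1 / 5) * (2 * real n powr (7 / 10) + 1)"
      unfolding of_nat_mult using k b by (intro mult_mono) auto
    also have "\<dots> \<le> real n" using large by simp
    finally have fit: "k * (2 * b + 1) \<le> n" by linarith
    have "6 * real D \<le> 6 * (real n powr (1 / 15) * (12 * real n + 1))"
      using t(2) unfolding D_def sq of_nat_mult by (intro mult_mono) auto
    also have "\<dots> \<le> (real n powr (7 / 10) - 1)\<^sup>2"
      using large by simp
    also have "\<dots> \<le> (real b)\<^sup>2"
      using b large by (intro power_mono) auto
    finally have "(6 * real D) ^ k \<le> ((real b)\<^sup>2) ^ k"
      by (intro power_mono) auto
    also have "\<dots> \<le> 3 * real s * real D ^ k"
      using sum_prod_rop_lower_bound[OF rop eq t(1) k_pos fit] by (simp add: D_def power_mult)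
    finally have "6 ^ k * real D ^ k \<le> (3 * real s) * real D ^ k"
      by (simp add: power_mult_distrib)
    moreover have "0 < D"
      using t(1) by (simp add: D_def)
    then have "0 < real D ^ k"
      by simp
    ultimately have "6 ^ k \<le> 3 * real s"
      by (rule mult_right_le_imp_le)
    \<comment> \<open>The factor 6 was chosen for this: \<open>3 ^ k\<close> absorbs the constant 3
      and leaves \<open>2 ^ k\<close>.\<close>
    moreover have "(3::real) * 2 ^ k \<le> 6 ^ k"
    proof -
      have "(3::real) \<le> 3 ^ k"
        using k_pos power_increasing[of 1 k "3::real"] by simp
      then have "(3::real) * 2 ^ k \<le> 3 ^ k * 2 ^ k"
        by (intro mult_right_mono) auto
      then show ?thesis
        by (simp flip: power_mult_distrib)
    qed
    ultimately have "2 ^ k \<le> real s" by linarith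
    then have "2 powr real k \<le> real s"
      by (simp add: powr_realpow)
    moreover have "2 powr (1 / 2 * real (n\<^sup>2) powr (1 / 10)) \<le> 2 powr real k"
      using k(1) unfolding sq by (intro powr_mono) auto
    ultimately show ?thesis
      by (rule order_trans[rotated])
  qed
  show ?thesis
    unfolding Let_def
  proof (rule exI[of _ "1 / 10"], rule exI[of _ "1 / 2"], rule exI[of _ n0], intro conjI allI impI)
    fix n s t :: nat and lam :: real and f :: "nat \<Rightarrow> nat \<Rightarrow> (nat \<times> nat, 'a) mpoly"
    assume *: "n0 \<le> n" "1 \<le> t" "real t \<le> real (n\<^sup>2) powr (1 / 30)"
      and rop: "\<forall>i\<in>{1..s}. \<forall>j\<in>{1..t}. is_rop ({1..n} \<times> {1..n}) (f i j) \<and>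
        real (s_rop ({1..n} \<times> {1..n}) (f i j)) \<le> real (n\<^sup>2) powr (1 / 2 + lam)"
      and eq: "(\<Sum>i = 1..s. \<Prod>j = 1..t. f i j) = permanent_poly n"
    show "2 powr (1 / 2 * real (n\<^sup>2) powr (1 / 10)) \<le> real s"
      by (rule bound[OF * _ eq]) (use rop in blast)
  qed simp_all
qed

end
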